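(* Consider the two-color nonlinear unbalanced urn model with replacement matrix $H=(H^{ij})_{i,j\in\{1,2\}}$, skewing function $f$, proportion process $(Z_n)_{n\ge0}$ and drift function $h$ described in the context. Assume: (C1) $f:[0,1]\to\mathbb{R}^+$ is continuous, non-decreasing and differentiable, with $f(0)=0$, $f(1)=1$, $f>0$ on $(0,1]$, and with finite right derivative at $0$ and finite left derivative at $1$; (C2) $H_1\neq H_2$, where $H_1=H^{11}+H^{21}$ and $H_2=H^{12}+H^{22}$; (C3) the urn is tenable, i.e. as long as the process is running the urn is never empty; (C4) the entries of $H$ are non-negative and not all zero, and moreover $H^{12}>0$ and $H^{21}>0$. If $\frac{H^{11}}{H_1}>\frac{H^{12}}{H_2}$, assume in addition that $f$ is concave. Furthermore, assume that the function $h$ is non-increasing on $[0,1]$. Let $y^*$ be the unique equilibrium point of $h$, i.e. the unique $y\in[0,1]$ with $h(y)=0$. Then for any $\varepsilon>0$ there exists a constant $a>0$, independent of $n$, such that for all $n$ large enough $$\mathbb{P}\big(|Z_{n+1}-y^*|>\varepsilon\big)\le 2e^{-an}.$$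
   Context: Urn model. All random variables are defined on a probability space $(\Omega,\mathcal{A},\mathbb{P})$. An urn contains balls of types $1$ and $2$; initially there are $Y_0^1\in\mathbb{N}^+$ balls of type $1$ and $Y_0^2\in\mathbb{N}^+$ balls of type $2$. The replacement matrix is $$H=\begin{pmatrix}H^{11}&H^{12}\\H^{21}&H^{22}\end{pmatrix},$$ with non-negative integer entries: if the drawn ball is of type $j$, then $H^{ij}$ balls of type $i$ are added, for each $i\in\{1,2\}$. Put $H_1=H^{11}+H^{21}$, $H_2=H^{12}+H^{22}$. Let $Y_n=(Y_n^1,Y_n^2)'\in\mathbb{N}^2\setminus\{0\}$ be the composition of the urn at stage $n$ and $T_n=Y_n^1+Y_n^2$ the total number of balls. Let $X_n\in\{e_1,e_2\}$ (the standard basis vectors of $\mathbb{R}^2$) be the type of the ball drawn at time $n$, and $\mathcal{F}_n$ the $\sigma$-algebra generated by the first $n$ steps. The drawing rule is $$\mathbb{P}(X_{n+1}=e_i\mid\mathcal{F}_n)=\frac{f(Y_n^i/T_n)}{f(Y_n^1/T_n)+f(Y_n^2/T_n)},\quad i\in\{1,2\},$$ where $f:[0,1]\to\mathbb{R}^+$, and the urn evolves by $Y_{n+1}=Y_n+HX_{n+1}$, $n\ge0$. The proportion of type $1$ balls is $Z_n=Y_n^1/T_n$. The drift function is $$h(y)=\frac{(H^{11}-yH_1)f(y)+(H^{12}-yH_2)f(1-y)}{f(y)+f(1-y)},\quad y\in[0,1].$$ Here $\mathbb{R}^+=[0,\infty)$. *)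

theory Defs
  imports "HOL-Probability.Probability"
begin

text \<open>
  Colours are the two elements \<open>1, 2\<close> of the index type \<open>2\<close>; \<open>H $ i $ j\<close> is the
  number of balls of colour \<open>i\<close> added when a ball of colour \<open>j\<close> is drawn.
\<close>

definition col_total :: "nat ^ 2 ^ 2 \<Rightarrow> 2 \<Rightarrow> nat" where
  "col_total H j = (\<Sum>i\<in>UNIV. H $ i $ j)"

definition urn_total :: "nat ^ 2 \<Rightarrow> nat" where
  "urn_total y = (\<Sum>i\<in>UNIV. y $ i)"

definition proportion :: "2 \<Rightarrow> nat ^ 2 \<Rightarrow> real" where
  "proportion i y = real (y $ i) / real (urn_total y)"

definition drift :: "nat ^ 2 ^ 2 \<Rightarrow> (real \<Rightarrow> real) \<Rightarrow> real \<Rightarrow> real" where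
  "drift H f y =
     ((real (H $ 1 $ 1) - y * real (col_total H 1)) * f y +
      (real (H $ 1 $ 2) - y * real (col_total H 2)) * f (1 - y)) /
     (f y + f (1 - y))"

definition equilibrium :: "nat ^ 2 ^ 2 \<Rightarrow> (real \<Rightarrow> real) \<Rightarrow> real" where
  "equilibrium H f = (THE y. y \<in> {0..1} \<and> drift H f y = 0)"

text \<open>
  The \<open>\<sigma>\<close>-algebra generated by the first \<open>n\<close> draws \<open>X 1, \<dots>, X n\<close>; the initial
  composition is deterministic. Writing it as a generated \<open>\<sigma>\<close>-algebra on \<open>space M\<close>
  gives the trivial one for \<open>n = 0\<close>, where a supremum of measures would have empty space.
\<close>

definition draw_filtration ::
  "'a measure \<Rightarrow> (nat \<Rightarrow> 'a \<Rightarrow> nat ^ 2) \<Rightarrow> nat \<Rightarrow> 'a measure" where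
  "draw_filtration M X n = sigma (space M) {X k -` A \<inter> space M | k A. k \<in> {1..n}}"

text \<open>
  A draw is recorded by the basis vector \<open>axis i 1\<close> of its colour. Draws are indexed
  from \<open>1\<close>, so \<open>X 0\<close> plays no role. The function \<open>f\<close> is only evaluated on \<open>{0..1}\<close>.
\<close>

locale nonlinear_urn = prob_space M
  for M :: "'a measure" +
  fixes H :: "nat ^ 2 ^ 2"
    and f :: "real \<Rightarrow> real"
    and y0 :: "nat ^ 2"
    and X :: "nat \<Rightarrow> 'a \<Rightarrow> nat ^ 2"
    and Y :: "nat \<Rightarrow> 'a \<Rightarrow> nat ^ 2"
  assumes initial_pos: "\<And>i. y0 $ i > 0"
    and initial: "\<And>\<omega>. \<omega> \<in> space M \<Longrightarrow> Y 0 \<omega> = y0"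
    and draw_measurable: "\<And>n. X (Suc n) \<in> measurable M (count_space UNIV)"
    and draw_colour: "\<And>n \<omega>. \<omega> \<in> space M \<Longrightarrow> X (Suc n) \<omega> \<in> {axis 1 1, axis 2 1}"
    and evolution: "\<And>n \<omega>. \<omega> \<in> space M \<Longrightarrow> Y (Suc n) \<omega> = Y n \<omega> + H *v X (Suc n) \<omega>"
    and drawing_rule: "\<And>n i. AE \<omega> in M.
      real_cond_exp M (draw_filtration M X n)
        (indicator {\<omega> \<in> space M. X (Suc n) \<omega> = axis i 1}) \<omega> =
      f (proportion i (Y n \<omega>)) /
        (f (proportion 1 (Y n \<omega>)) + f (proportion 2 (Y n \<omega>)))"

end

theory Submission
  imports Defs "HOL-Real_Asymp.Real_Asymp"
begin

text \<open>
  Write \<open>Z\<close> for the proportion of colour \<open>1\<close>, \<open>T\<close> for the number of balls, \<open>e\<close> for the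
  equilibrium and \<open>h\<close> for the drift. One draw changes \<open>Z\<close> by at most \<open>C / T\<close>, and by
  \<open>h(Z) / T\<close> on average, up to an error of order \<open>1 / T\<^sup>2\<close>; and \<open>T\<close> grows linearly
  because every column of \<open>H\<close> has a positive sum. The function \<open>h\<close> is non-increasing with a single
  zero, so beyond \<open>e + \<epsilon> / 2\<close> it is at most some \<open>- \<delta> < 0\<close>, and below \<open>e - \<epsilon> / 2\<close> at
  least some \<open>\<delta> > 0\<close>. Far from the equilibrium \<open>Z\<close> is thus pushed back with speed at least
  \<open>\<delta> / T\<close>. The two tails are the same estimate applied to \<open>Z\<close> and to \<open>- Z\<close>; the sign
  \<open>sg\<close> below selects one of them.

  To bound the tail at time \<open>N\<close>, fix the exponent \<open>s N\<close> and follow the moments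
  \<open>E n = E[exp (s N (sg Z - c))]\<close> at times \<open>n\<close> from \<open>\<kappa> N\<close> to \<open>N\<close>. There a single draw changes the
  exponent by a bounded amount, and for small \<open>s\<close> the drift beats the second-order terms, whence
  \<open>E (n + 1) \<le> exp (- const N / (n + 1)) E n + exp 1\<close>
  (\<open>exponential_moment_recursion\<close>). The moment at time \<open>\<kappa> N\<close> is at most
  \<open>exp (const N)\<close> for the trivial reason that \<open>Z\<close> is bounded. The sum of \<open>1 / (n + 1)\<close> over the
  window is at least about \<open>ln (1 / \<kappa>)\<close>, hence for small enough \<open>\<kappa>\<close> the accumulated contraction cancels
  this initial value and \<open>E N \<le> 1 + exp 1 * N\<close>. Markov's inequality at distance
  \<open>\<eta>\<close> from \<open>c\<close> gains \<open>exp (- s \<eta> N)\<close>, which absorbs the linear factor (\<open>one_sided_tail\<close>).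

  That \<open>h\<close> has only one zero does not follow from monotonicity alone: it could vanish on an interval.
  This is excluded in \<open>drift_zero_unique\<close>, where concavity of the skewing function enters.
\<close>

section \<open>Real estimates\<close>

lemma exp_le_quadratic:
  fixes x :: real
  assumes "\<bar>x\<bar> \<le> 1"
  shows "exp x \<le> 1 + x + x\<^sup>2"
proof (cases "x \<ge> 0")
  case True
  then show ?thesis using exp_bound assms by simp
next
  case False
  define u where "u = - x"
  have u: "0 \<le> u" "u \<le> 1" using False assms by (auto simp: u_def)
  have "1 \<le> 1 + u\<^sup>2 / 2 + u ^ 3 / 2 + u ^ 4 / 2" using u by simp
  also have "\<dots> = (1 - u + u\<^sup>2) * (1 + u + u\<^sup>2 / 2)"
    by (simp add: field_simps power2_eq_square power3_eq_cube power4_eq_xxxx)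
  also have "\<dots> \<le> (1 - u + u\<^sup>2) * exp u"
    using u exp_lower_Taylor_quadratic[of u] by (intro mult_left_mono) auto
  finally have "exp (- u) \<le> 1 - u + u\<^sup>2"
    by (simp add: exp_minus field_simps)
  then show ?thesis by (simp add: u_def)
qed

text \<open>
  With \<open>T\<close> balls and proportion \<open>z\<close>, adding \<open>b\<close> balls of which \<open>a\<close> have colour \<open>1\<close> moves the
  proportion by \<open>(a - z * b) / (T + b)\<close>. The second bound replaces the denominator by \<open>T\<close>, so that
  averaging over the drawn colour produces the drift divided by \<open>T\<close>.
\<close>
lemma proportion_increment_bounds:
  fixes a b C z T :: real
  assumes "0 \<le> a" "a \<le> b" "b \<le> C" "0 \<le> z" "z \<le> 1" "0 < T"
  shows "\<bar>(a - z * b) / (T + b)\<bar> \<le> C / T"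
    and "\<bar>(a - z * b) / (T + b) - (a - z * b) / T\<bar> \<le> C\<^sup>2 / T\<^sup>2"
proof -
  have zb: "0 \<le> z * b" "z * b \<le> b"
    using assms by (auto intro: mult_left_le_one_le)
  have num: "\<bar>a - z * b\<bar> \<le> C" using zb assms by linarith
  show "\<bar>(a - z * b) / (T + b)\<bar> \<le> C / T"
    unfolding abs_divide using num assms by (intro frac_le) auto
  have "(a - z * b) / (T + b) - (a - z * b) / T = - (a - z * b) * b / (T * (T + b))"
    using assms by (simp add: field_simps)
  then have "\<bar>(a - z * b) / (T + b) - (a - z * b) / T\<bar> = \<bar>a - z * b\<bar> * b / (T * (T + b))"
    using assms by (simp add: abs_mult abs_minus_commute)
  also have "\<dots> \<le> (C * C) / (T * T)"
    using assms num by (intro frac_le mult_mono) auto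
  finally show "\<bar>(a - z * b) / (T + b) - (a - z * b) / T\<bar> \<le> C\<^sup>2 / T\<^sup>2"
    by (simp add: power2_eq_square)
qed

lemma sum_reciprocals_ge_ln:
  assumes "m \<le> n"
  shows "ln (real (Suc n) / real (Suc m)) \<le> (\<Sum>k=m..<n. 1 / real (Suc k))"
  using assms
proof (induction n rule: dec_induct)
  case base
  then show ?case by simp
next
  case (step n)
  have "ln (real (Suc (Suc n)) / real (Suc m))
      = ln (real (Suc n) / real (Suc m)) + ln (1 + 1 / real (Suc n))"
  proof (subst ln_mult_pos [symmetric])
    have "1 + 1 / real (Suc n) = real (Suc (Suc n)) / real (Suc n)" by (simp add: field_simps)
    then show "ln (real (Suc (Suc n)) / real (Suc m))
        = ln (real (Suc n) / real (Suc m) * (1 + 1 / real (Suc n)))" by simp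
  qed (auto simp: add_pos_nonneg)
  also have "\<dots> \<le> (\<Sum>k=m..<n. 1 / real (Suc k)) + 1 / real (Suc n)"
    by (intro add_mono step.IH ln_add_one_self_le_self) auto
  finally show ?case using step.hyps by simp
qed

text \<open>
  The contraction factors multiply on the initial value; on the additive terms they are merely bounded
  by \<open>1\<close>, which costs a factor linear in the number of steps.
\<close>
lemma affine_recursion_bound:
  fixes e u :: "nat \<Rightarrow> real"
  assumes "m \<le> n"
    and "\<And>k. m \<le> k \<Longrightarrow> k < n \<Longrightarrow> e (Suc k) \<le> exp (- u k) * e k + b"
    and "\<And>k. m \<le> k \<Longrightarrow> k < n \<Longrightarrow> 0 \<le> u k" and "0 \<le> b"
  shows "e n \<le> exp (- (\<Sum>k=m..<n. u k)) * e m + b * real (n - m)"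
  using assms
proof (induction n rule: dec_induct)
  case base
  then show ?case by simp
next
  case (step n)
  have IH: "e n \<le> exp (- (\<Sum>k=m..<n. u k)) * e m + b * real (n - m)"
    using step by auto
  have "e (Suc n) \<le> exp (- u n) * e n + b" using step by auto
  also have "exp (- u n) * e n
      \<le> exp (- u n) * (exp (- (\<Sum>k=m..<n. u k)) * e m + b * real (n - m))"
    using IH by simp
  also have "\<dots> = exp (- (\<Sum>k=m..<Suc n. u k)) * e m + exp (- u n) * (b * real (n - m))"
    using step.hyps by (simp add: algebra_simps flip: exp_add)
  also have "exp (- u n) * (b * real (n - m)) \<le> 1 * (b * real (n - m))"
    using step.prems step.hyps by (intro mult_right_mono) auto
  finally show ?case using step.hyps by (simp add: Suc_diff_le algebra_simps)
qed

section \<open>One draw from a fixed composition\<close>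

definition draw_prob :: "(real \<Rightarrow> real) \<Rightarrow> 2 \<Rightarrow> nat ^ 2 \<Rightarrow> real" where
  "draw_prob f i y = f (proportion i y) / (f (proportion 1 y) + f (proportion 2 y))"

definition add_balls :: "nat ^ 2 ^ 2 \<Rightarrow> 2 \<Rightarrow> nat ^ 2 \<Rightarrow> nat ^ 2" where
  "add_balls H i y = y + H *v axis i 1"

lemma add_balls_nth: "add_balls H i y $ j = y $ j + H $ j $ i"
  using exhaust_2[of i] by (auto simp: add_balls_def matrix_vector_mult_def sum_2 axis_def)

lemma urn_total_2: "urn_total y = y $ 1 + y $ 2"
  by (simp add: urn_total_def sum_2)

lemma col_total_2: "col_total H i = H $ 1 $ i + H $ 2 $ i"
  by (simp add: col_total_def sum_2)

lemma urn_total_add_balls: "urn_total (add_balls H i y) = urn_total y + col_total H i"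
  by (simp add: urn_total_2 col_total_2 add_balls_nth)

lemma proportion_bounds: "0 \<le> proportion i y" "proportion i y \<le> 1"
  using exhaust_2[of i] by (auto simp: proportion_def urn_total_2 divide_simps)

lemma proportion_2: "urn_total y > 0 \<Longrightarrow> proportion 2 y = 1 - proportion 1 y"
  by (auto simp: proportion_def urn_total_2 eq_diff_eq simp flip: add_divide_distrib)

lemma proportion_add_balls:
  assumes "urn_total y > 0"
  shows "proportion 1 (add_balls H i y) = proportion 1 y +
    (real (H $ 1 $ i) - proportion 1 y * real (col_total H i)) /
      (real (urn_total y) + real (col_total H i))"
  using assms unfolding proportion_def urn_total_add_balls add_balls_nth
  by (simp add: divide_simps) (simp add: algebra_simps)

text \<open>The denominator of the drawing rule: \<open>y\<close> and \<open>1 - y\<close> are not both \<open>0\<close>.\<close>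
lemma skew_sum_pos:
  fixes f :: "real \<Rightarrow> real"
  assumes "\<forall>x\<in>{0..1}. f x \<ge> 0" "\<forall>x\<in>{0<..1}. f x > 0" "y \<in> {0..1}"
  shows "f y + f (1 - y) > 0"
proof (cases "y = 0")
  case True
  then show ?thesis using assms by (intro add_nonneg_pos) auto
next
  case False
  then show ?thesis using assms by (intro add_pos_nonneg) auto
qed

lemma draw_prob_simplex:
  fixes f :: "real \<Rightarrow> real"
  assumes "\<forall>x\<in>{0..1}. f x \<ge> 0" "\<forall>x\<in>{0<..1}. f x > 0" "urn_total y > 0"
  shows "0 \<le> draw_prob f i y" and "(\<Sum>i\<in>UNIV. draw_prob f i y) = 1"
proof -
  have "f (proportion 1 y) + f (proportion 2 y) > 0"
    unfolding proportion_2[OF assms(3)]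
    by (rule skew_sum_pos) (use assms proportion_bounds in auto)
  then show "0 \<le> draw_prob f i y" "(\<Sum>i\<in>UNIV. draw_prob f i y) = 1"
    using assms(1) proportion_bounds
    by (auto simp: draw_prob_def sum_2 add_divide_distrib[symmetric])
qed

lemma drift_eq_mean_increment:
  assumes "urn_total y > 0"
  shows "drift H f (proportion 1 y) =
    (\<Sum>i\<in>UNIV. draw_prob f i y * (real (H $ 1 $ i) - proportion 1 y * real (col_total H i)))"
  by (simp add: drift_def draw_prob_def sum_2 proportion_2[OF assms] add_divide_distrib mult.commute)

text \<open>
  As \<open>l\<close> is at most of the order of \<open>T\<close>, one draw changes the exponent by at most \<open>1\<close>. This alone
  gives the second bound, used on the side of \<open>c\<close> where the drift is not controlled. The first bound
  expands the exponential to second order: the linear term averages to the drift, and its correction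
  and the square are of order \<open>l / T\<^sup>2\<close> and \<open>l\<^sup>2 / T\<^sup>2\<close>.
\<close>
lemma exponential_step_bound:
  fixes H :: "nat ^ 2 ^ 2" and f :: "real \<Rightarrow> real" and l c sg :: real
  defines "C \<equiv> real (col_total H 1) + real (col_total H 2)"
  assumes f: "\<forall>x\<in>{0..1}. f x \<ge> 0" "\<forall>x\<in>{0<..1}. f x > 0"
    and y: "urn_total y > 0" and sg: "\<bar>sg\<bar> = 1"
    and l: "0 \<le> l" "l * C \<le> urn_total y"
  shows "(\<Sum>i\<in>UNIV. draw_prob f i y * exp (l * (sg * proportion 1 (add_balls H i y) - c)))
    \<le> exp (l * (sg * proportion 1 y - c)) *
       exp (l * (sg * drift H f (proportion 1 y)) / urn_total y + (l + l\<^sup>2) * C\<^sup>2 / (urn_total y)\<^sup>2)"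
    and "(\<Sum>i\<in>UNIV. draw_prob f i y * exp (l * (sg * proportion 1 (add_balls H i y) - c)))
    \<le> exp (l * (sg * proportion 1 y - c)) * exp 1"
proof -
  define T z p where "T = real (urn_total y)" and "z = proportion 1 y" and "p i = draw_prob f i y" for i
  define v where "v i = real (H $ 1 $ i) - z * real (col_total H i)" for i
  define d where "d i = sg * (v i / (T + real (col_total H i)))" for i
  have T: "T > 0" using y by (simp add: T_def)
  have p: "0 \<le> p i" "(\<Sum>i\<in>UNIV. p i) = 1" for i
    using draw_prob_simplex[OF f y] by (auto simp: p_def)
  have inc: "sg * proportion 1 (add_balls H i y) = sg * z + d i" for i
    unfolding proportion_add_balls[OF y] d_def v_def z_def T_def by (simp add: algebra_simps)
  have col: "real (col_total H i) \<le> C" for i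
    using exhaust_2[of i] by (auto simp: C_def)
  note bnds = proportion_increment_bounds[of "real (H $ 1 $ i)" "real (col_total H i)" C z T for i,
      OF _ _ col _ _ T, folded v_def]
  have d1: "\<bar>d i\<bar> \<le> C / T" for i
    using bnds(1)[of i] sg proportion_bounds[of 1 y] by (simp add: d_def abs_mult col_total_2 z_def)
  have d2: "d i \<le> sg * v i / T + C\<^sup>2 / T\<^sup>2" for i
  proof -
    have "\<bar>d i - sg * v i / T\<bar> = \<bar>sg\<bar> * \<bar>v i / (T + real (col_total H i)) - v i / T\<bar>"
      unfolding abs_mult[symmetric] d_def by (simp add: algebra_simps)
    also have "\<dots> \<le> C\<^sup>2 / T\<^sup>2"
      using bnds(2)[of i] sg proportion_bounds[of 1 y] by (simp add: col_total_2 z_def)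
    finally show ?thesis by linarith
  qed
  have ld: "\<bar>l * d i\<bar> \<le> 1" for i
  proof -
    have "\<bar>l * d i\<bar> \<le> l * (C / T)" using mult_left_mono[OF d1 l(1)] l(1) by (simp add: abs_mult)
    also have "\<dots> \<le> 1" using l T by (simp add: T_def)
    finally show ?thesis .
  qed
  have step: "exp (l * d i) \<le> 1 + (l * C\<^sup>2 / T\<^sup>2 + l\<^sup>2 * C\<^sup>2 / T\<^sup>2) + l * sg / T * v i" for i
  proof -
    have "exp (l * d i) \<le> 1 + l * d i + l\<^sup>2 * (d i)\<^sup>2"
      using exp_le_quadratic[OF ld] by (simp add: power_mult_distrib)
    also have "l * d i \<le> l * (sg * v i / T + C\<^sup>2 / T\<^sup>2)"
      using d2 l by (intro mult_left_mono) auto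
    also have "l\<^sup>2 * (d i)\<^sup>2 \<le> l\<^sup>2 * (C / T)\<^sup>2"
      using power_mono[OF d1[of i], of 2] by (intro mult_left_mono) auto
    finally show ?thesis by (simp add: algebra_simps power_divide)
  qed
  have eq: "(\<Sum>i\<in>UNIV. draw_prob f i y * exp (l * (sg * proportion 1 (add_balls H i y) - c)))
      = exp (l * (sg * z - c)) * (\<Sum>i\<in>UNIV. p i * exp (l * d i))"
    unfolding inc sum_distrib_left
    by (intro sum.cong) (auto simp: p_def algebra_simps simp flip: exp_add)
  have "(\<Sum>i\<in>UNIV. p i * exp (l * d i))
      \<le> (\<Sum>i\<in>UNIV. p i * (1 + (l * C\<^sup>2 / T\<^sup>2 + l\<^sup>2 * C\<^sup>2 / T\<^sup>2) + l * sg / T * v i))"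
    by (intro sum_mono mult_left_mono step p)
  also have "\<dots> = (\<Sum>i\<in>UNIV. p i) * (1 + (l * C\<^sup>2 / T\<^sup>2 + l\<^sup>2 * C\<^sup>2 / T\<^sup>2))
      + l * sg / T * (\<Sum>i\<in>UNIV. p i * v i)"
    by (simp add: sum_2 algebra_simps add_divide_distrib)
  also have "\<dots> = 1 + (l * (sg * drift H f z) / T + (l + l\<^sup>2) * C\<^sup>2 / T\<^sup>2)"
    using p(2) drift_eq_mean_increment[OF y, of H f]
    by (simp flip: p_def v_def z_def) (simp add: algebra_simps add_divide_distrib)
  also have "\<dots> \<le> exp (l * (sg * drift H f z) / T + (l + l\<^sup>2) * C\<^sup>2 / T\<^sup>2)"
    by (rule exp_ge_add_one_self)
  finally show "(\<Sum>i\<in>UNIV. draw_prob f i y * exp (l * (sg * proportion 1 (add_balls H i y) - c)))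
    \<le> exp (l * (sg * proportion 1 y - c)) *
       exp (l * (sg * drift H f (proportion 1 y)) / urn_total y + (l + l\<^sup>2) * C\<^sup>2 / (urn_total y)\<^sup>2)"
    unfolding eq by (simp add: T_def z_def)
  have "(\<Sum>i\<in>UNIV. p i * exp (l * d i)) \<le> (\<Sum>i\<in>UNIV. p i * exp 1)"
    using ld by (intro sum_mono mult_left_mono p) (simp add: abs_le_iff)
  also have "\<dots> = exp 1" using p(2) by (simp flip: sum_distrib_right)
  finally show "(\<Sum>i\<in>UNIV. draw_prob f i y * exp (l * (sg * proportion 1 (add_balls H i y) - c)))
    \<le> exp (l * (sg * proportion 1 y - c)) * exp 1"
    unfolding eq by (simp add: z_def)
qed

section \<open>The unique zero of the drift\<close>

text \<open>The slope \<open>f x / x\<close> of the chord from the origin decreases, stated without division.\<close>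
lemma concave_ratio_antimono:
  fixes f :: "real \<Rightarrow> real"
  assumes "concave_on {0..1} f" "f 0 = 0" "0 < x" "x \<le> y" "y \<le> 1"
  shows "x * f y \<le> y * f x"
proof -
  have "(1 - x / y) * f 0 + (x / y) * f y \<le> f ((1 - x / y) *\<^sub>R 0 + (x / y) *\<^sub>R y)"
    using assms by (intro concave_onD[of "{0..1}" f]) auto
  then show ?thesis using assms by (simp add: field_simps)
qed

text \<open>
  Let \<open>r / u\<close> and \<open>s / v\<close> be the proportions of colour \<open>1\<close> among the balls added after drawing
  colours \<open>1\<close> and \<open>2\<close>. At a zero, \<open>y\<close> is the average of these two numbers with weights
  \<open>u * f y\<close> and \<open>v * f (1 - y)\<close>. The share of the first weight is non-decreasing in \<open>y\<close>, as \<open>f\<close> is monotone.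

  If \<open>r / u \<le> s / v\<close>, the average is therefore non-increasing in \<open>y\<close> and meets \<open>y\<close> only once.
  Otherwise a zero satisfies \<open>f y / f (1 - y) = (y * v - s) / (r - y * u)\<close>. Multiply both sides by
  \<open>(1 - y) / y\<close>. Concavity makes the left-hand side non-increasing, while the right-hand side
  is the product of \<open>v - s / y\<close> and \<open>(1 - y) / (r - y * u)\<close>, both positive and strictly increasing
  because \<open>s > 0\<close> and \<open>r < u\<close>. So two zeros cannot coexist.
\<close>
lemma drift_zero_unique:
  fixes f :: "real \<Rightarrow> real"
  assumes f: "\<forall>x\<in>{0..1}. f x \<ge> 0" "\<forall>x\<in>{0<..1}. f x > 0" "f 0 = 0"
    and mono: "mono_on {0..1} f"
    and H: "H $ 1 $ 2 > 0" "H $ 2 $ 1 > 0"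
    and concave: "real (H $ 1 $ 1) / real (col_total H 1) >
        real (H $ 1 $ 2) / real (col_total H 2) \<longrightarrow> concave_on {0..1} f"
    and ab: "a \<in> {0..1}" "b \<in> {0..1}" "a < b"
    and zero: "drift H f a = 0" "drift H f b = 0"
  shows False
proof -
  define r s u v where "r = real (H $ 1 $ 1)" and "s = real (H $ 1 $ 2)"
    and "u = real (col_total H 1)" and "v = real (col_total H 2)"
  have H': "0 \<le> r" "r < u" "0 < s" "s \<le> v" "0 < u" "0 < v"
    using H by (auto simp: r_def s_def u_def v_def col_total_2)
  have num: "(r - y * u) * f y + (s - y * v) * f (1 - y) = 0"
    if "y \<in> {0..1}" "drift H f y = 0" for y
    using that skew_sum_pos[OF f(1,2) that(1)]
    by (simp add: drift_def r_def s_def u_def v_def)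
  note za = num[OF ab(1) zero(1)] and zb = num[OF ab(2) zero(2)]
  have a0: "a \<noteq> 0" using za f(2)[rule_format, of 1] f(3) H' by auto
  have b1: "b \<noteq> 1" using zb f(2)[rule_format, of 1] f(3) H' by auto
  have ab': "0 < a" "a < 1" "0 < b" "b < 1" using ab a0 b1 by auto
  have pos: "f a > 0" "f (1 - a) > 0" "f b > 0" "f (1 - b) > 0"
    using f(2) ab' by auto
  have le: "f a \<le> f b" "f (1 - b) \<le> f (1 - a)"
    using ab' ab(3) by (auto intro!: mono_onD[OF mono])
  show False
  proof (cases "r * v \<le> s * u")
    case True
    have "a * (u * f a + v * f (1 - a)) = r * f a + s * f (1 - a)"
      "b * (u * f b + v * f (1 - b)) = r * f b + s * f (1 - b)"
      using za zb by (simp_all add: algebra_simps)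
    then have "(b - a) * ((u * f a + v * f (1 - a)) * (u * f b + v * f (1 - b)))
      = (r * f b + s * f (1 - b)) * (u * f a + v * f (1 - a))
        - (r * f a + s * f (1 - a)) * (u * f b + v * f (1 - b))"
      by algebra
    also have "\<dots> = (r * v - s * u) * (f b * f (1 - a) - f a * f (1 - b))"
      by (simp add: algebra_simps)
    also have "\<dots> \<le> 0"
      using True le pos by (intro mult_nonpos_nonneg) (auto intro!: mult_mono)
    moreover have "(b - a) * ((u * f a + v * f (1 - a)) * (u * f b + v * f (1 - b))) > 0"
      using ab(3) H' pos by (intro mult_pos_pos add_pos_pos) auto
    ultimately show False by linarith
  next
    case False
    then have "r / u > s / v" using H' by (simp add: field_simps)
    then have conc: "concave_on {0..1} f" using concave by (simp add: r_def s_def u_def v_def)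
    have c1: "a * f b \<le> b * f a"
      using concave_ratio_antimono[OF conc f(3), of a b] ab ab' by auto
    have c2: "(1 - b) * f (1 - a) \<le> (1 - a) * f (1 - b)"
      using concave_ratio_antimono[OF conc f(3), of "1 - b" "1 - a"] ab ab' by auto
    \<comment> \<open>A zero lies strictly between \<open>s / v\<close> and \<open>r / u\<close>, so the quotients below have positive terms.\<close>
    have between: "0 < r - y * u \<and> 0 < y * v - s"
      if z: "(r - y * u) * f y + (s - y * v) * f (1 - y) = 0"
        and y: "f y > 0" "f (1 - y) > 0" for y
    proof -
      have eq: "(r - y * u) * f y = (y * v - s) * f (1 - y)" using z by (simp add: algebra_simps)
      have "0 < r - y * u"
      proof (rule ccontr)
        assume neg: "\<not> 0 < r - y * u"
        then have "(y * v - s) * f (1 - y) \<le> 0"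
          using y unfolding eq[symmetric] by (intro mult_nonpos_nonneg) auto
        then have "y * v \<le> s" using y by (simp add: mult_le_0_iff)
        then have "r * v \<le> y * u * v" "y * v * u \<le> s * u"
          using neg H' by (auto intro!: mult_right_mono)
        then show False using False by (simp add: mult_ac)
      qed
      moreover from this have "0 < (y * v - s) * f (1 - y)" using y eq by (metis mult_pos_pos)
      ultimately show ?thesis using y by (simp add: zero_less_mult_iff)
    qed
    define A A' B B' where "A = r - a * u" and "A' = a * v - s" and "B = r - b * u" and "B' = b * v - s"
    have P: "0 < A" "0 < A'" "0 < B" "0 < B'"
      using between[OF za pos(1,2)] between[OF zb pos(3,4)] by (auto simp: A_def A'_def B_def B'_def)
    have E: "A * f a = A' * f (1 - a)" "B * f b = B' * f (1 - b)"
      using za zb by (auto simp: A_def A'_def B_def B'_def algebra_simps)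
    \<comment> \<open>The strict monotonicity of the two factors of the right-hand side, cleared of denominators.\<close>
    have s1: "A' * b < B' * a"
      using ab(3) H' by (simp add: A'_def B'_def algebra_simps)
    have "(b - a) * (u - r) > 0" using ab(3) H' by simp
    then have s2: "B * (1 - a) < A * (1 - b)"
      by (simp add: A_def B_def algebra_simps)
    have "(a * f b) * ((1 - b) * f (1 - a)) \<le> (b * f a) * ((1 - a) * f (1 - b))"
      using c1 c2 ab' pos by (intro mult_mono[of "a * f b" "b * f a"]) auto
    then have "(a * f b) * ((1 - b) * f (1 - a)) * (A * B') \<le> (b * f a) * ((1 - a) * f (1 - b)) * (A * B')"
      using P by (intro mult_right_mono) auto
    also have "\<dots> = (b * (1 - a)) * ((A * f a) * (B' * f (1 - b)))" by (simp add: mult_ac)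
    also have "\<dots> = (b * (1 - a)) * ((A' * f (1 - a)) * (B * f b))" using E by simp
    also have "\<dots> = ((A' * b) * (B * (1 - a))) * (f (1 - a) * f b)" by (simp add: mult_ac)
    also have "\<dots> < ((B' * a) * (A * (1 - b))) * (f (1 - a) * f b)"
      using s1 s2 P ab' pos
      by (intro mult_strict_right_mono mult_strict_mono[of "A' * b" "B' * a"]) auto
    finally show False by (simp add: mult_ac)
  qed
qed

lemma drift_zero_exists:
  fixes f :: "real \<Rightarrow> real"
  assumes f: "\<forall>x\<in>{0..1}. f x \<ge> 0" "\<forall>x\<in>{0<..1}. f x > 0" "f 0 = 0" "continuous_on {0..1} f"
  shows "\<exists>y\<in>{0..1}. drift H f y = 0"
proof -
  have "continuous_on {0..1} (\<lambda>y. f (1 - y))"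
    by (intro continuous_on_compose2[OF f(4)] continuous_intros) auto
  then have "continuous_on {0..1} (drift H f)"
    unfolding drift_def using f(4) skew_sum_pos[OF f(1,2)]
    by (intro continuous_intros) (auto simp: less_imp_neq[symmetric])
  moreover have "drift H f 1 \<le> 0" "0 \<le> drift H f 0"
    using f(2,3) by (auto simp: drift_def col_total_2)
  ultimately obtain y where "0 \<le> y" "y \<le> 1" "drift H f y = 0"
    using IVT2'[of "drift H f" 1 0 0] by auto
  then show ?thesis by auto
qed

text \<open>
  Monotonicity propagates the strict sign of the drift at \<open>e + sg * \<eta>\<close> to everything beyond. If that point
  falls outside the unit interval, nothing lies beyond it and any \<open>\<delta>\<close> will do.
\<close>
lemma drift_strict_sign:
  fixes f :: "real \<Rightarrow> real"
  assumes anti: "antimono_on {0..1} (drift H f)"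
    and e: "e \<in> {0..1}" "drift H f e = 0"
    and uniq: "\<And>y. y \<in> {0..1} \<Longrightarrow> drift H f y = 0 \<Longrightarrow> y = e"
    and sg: "sg \<in> {1, -1}" and "\<eta> > 0"
  obtains \<delta> where "\<delta> > 0" "\<And>z. z \<in> {0..1} \<Longrightarrow> sg * z \<ge> sg * e + \<eta> \<Longrightarrow> sg * drift H f z \<le> - \<delta>"
proof (cases "e + sg * \<eta> \<in> {0..1}")
  case True
  define w where "w = e + sg * \<eta>"
  have w: "w \<in> {0..1}" "w \<noteq> e" using True sg \<open>\<eta> > 0\<close> by (auto simp: w_def)
  have nz: "drift H f w \<noteq> 0" using uniq w by blast
  have anti': "drift H f y \<le> drift H f x" if "x \<in> {0..1}" "y \<in> {0..1}" "x \<le> y" for x y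
    using anti that by (auto simp: monotone_on_def)
  show thesis
  proof (rule that[of "- (sg * drift H f w)"])
    show "0 < - (sg * drift H f w)"
      using sg anti'[OF e(1) w(1)] anti'[OF w(1) e(1)] nz e(2) \<open>\<eta> > 0\<close> by (auto simp: w_def)
    fix z :: real assume z: "z \<in> {0..1}" "sg * z \<ge> sg * e + \<eta>"
    show "sg * drift H f z \<le> - (- (sg * drift H f w))"
      using sg z anti'[OF w(1) z(1)] anti'[OF z(1) w(1)] by (auto simp: w_def)
  qed
next
  case False
  show thesis
  proof (rule that[of 1])
    fix z :: real assume z: "z \<in> {0..1}" "sg * z \<ge> sg * e + \<eta>"
    then show "sg * drift H f z \<le> - 1"
      using False sg e(1) \<open>\<eta> > 0\<close> by auto
  qed simp
qed


section \<open>The urn as a Markov chain\<close>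

context nonlinear_urn
begin

lemma subalgebra_draws: "subalgebra M (draw_filtration M X n)"
proof -
  have "X k -` A \<inter> space M \<in> sets M" if k: "k \<in> {1..n}" for k A
  proof -
    obtain l where "k = Suc l" using k by (cases k) auto
    then show ?thesis using measurable_sets[OF draw_measurable[of l], of A] by simp
  qed
  then have gen: "{X k -` A \<inter> space M |k A. k \<in> {1..n}} \<subseteq> sets M" by blast
  then have "{X k -` A \<inter> space M |k A. k \<in> {1..n}} \<subseteq> Pow (space M)"
    using sets.sets_into_space by blast
  then show ?thesis
    unfolding subalgebra_def draw_filtration_def
    using sets.sigma_sets_subset[OF gen] by (simp only: sets_measure_of space_measure_of)
qed

lemma space_draws [simp]: "space (draw_filtration M X n) = space M"
  using subalgebra_draws by (simp add: subalgebra_def)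

lemma draw_measurable_filtration:
  assumes "k \<in> {1..n}"
  shows "X k \<in> measurable (draw_filtration M X n) (count_space UNIV)"
proof (rule measurableI)
  fix A
  have "{X k -` A \<inter> space M |k A. k \<in> {1..n}} \<subseteq> Pow (space M)" by auto
  then show "X k -` A \<inter> space (draw_filtration M X n) \<in> sets (draw_filtration M X n)"
    unfolding space_draws draw_filtration_def using assms by (auto intro!: in_measure_of)
qed simp

lemma composition_measurable_filtration:
  "m \<le> n \<Longrightarrow> Y m \<in> measurable (draw_filtration M X n) (count_space UNIV)"
proof (induction m)
  case 0
  have "(\<lambda>_. y0) \<in> measurable (draw_filtration M X n) (count_space UNIV)" by simp
  then show ?case
    by (subst measurable_cong[of _ _ "\<lambda>_. y0"]) (auto simp: initial)
next
  case (Suc m)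
  have Y: "Y m \<in> measurable (draw_filtration M X n) (count_space UNIV)"
    using Suc by simp
  have X: "X (Suc m) \<in> measurable (draw_filtration M X n) (count_space UNIV)"
    using Suc.prems by (intro draw_measurable_filtration) auto
  have "(\<lambda>\<omega>. y + H *v X (Suc m) \<omega>) \<in> measurable (draw_filtration M X n) (count_space UNIV)"
    for y by (rule measurable_compose[OF X]) simp
  from measurable_compose_countable[OF this Y]
  show ?case
    by (subst measurable_cong[of _ _ "\<lambda>\<omega>. Y m \<omega> + H *v X (Suc m) \<omega>"]) (auto simp: evolution)
qed

lemma composition_measurable: "Y n \<in> measurable M (count_space UNIV)"
  using measurable_from_subalg[OF subalgebra_draws composition_measurable_filtration] by blast

lemma composition_fun_measurable: "(\<lambda>\<omega>. g (Y n \<omega>) :: real) \<in> borel_measurable M"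
  by (rule measurable_compose[OF composition_measurable]) simp

lemma composition_fun_integrable:
  assumes "\<And>y. \<bar>g y\<bar> \<le> K"
  shows "integrable M (\<lambda>\<omega>. g (Y n \<omega>) :: real)"
  by (rule integrable_const_bound[of _ K]) (use assms composition_fun_measurable in auto)

text \<open>
  The drawing rule in integrated form: the composition at time \<open>n\<close> is measurable for the first \<open>n\<close>
  draws, so it can be taken out of the conditional expectation.
\<close>
lemma integral_draw:
  fixes g :: "nat ^ 2 \<Rightarrow> real"
  assumes bound: "\<And>y. \<bar>g y\<bar> \<le> K"
  defines "S \<equiv> \<lambda>i n. {\<omega> \<in> space M. X (Suc n) \<omega> = axis i 1}"
  shows "integrable M (\<lambda>\<omega>. g (Y n \<omega>) * indicator (S i n) \<omega>)"
    and "integrable M (\<lambda>\<omega>. g (Y n \<omega>) * draw_prob f i (Y n \<omega>))"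
    and "(\<integral>\<omega>. g (Y n \<omega>) * indicator (S i n) \<omega> \<partial>M)
      = (\<integral>\<omega>. g (Y n \<omega>) * draw_prob f i (Y n \<omega>) \<partial>M)"
proof -
  interpret F: finite_measure_subalgebra M "draw_filtration M X n"
    by unfold_locales (rule subalgebra_draws)
  have S: "S i n \<in> sets M"
  proof -
    have "S i n = X (Suc n) -` {axis i 1} \<inter> space M" by (auto simp: S_def)
    then show ?thesis using measurable_sets[OF draw_measurable[of n], of "{axis i 1}"] by simp
  qed
  show int: "integrable M (\<lambda>\<omega>. g (Y n \<omega>) * indicator (S i n) \<omega>)"
    using S composition_fun_integrable[OF bound] by (rule integrable_real_mult_indicator)
  have gY: "(\<lambda>\<omega>. g (Y n \<omega>)) \<in> borel_measurable (draw_filtration M X n)"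
    by (rule measurable_compose[OF composition_measurable_filtration]) auto
  have AE: "AE \<omega> in M. g (Y n \<omega>) * real_cond_exp M (draw_filtration M X n) (indicator (S i n)) \<omega>
      = g (Y n \<omega>) * draw_prob f i (Y n \<omega>)"
    using drawing_rule[of n i] by (auto simp: S_def draw_prob_def)
  have meas: "(\<lambda>\<omega>. g (Y n \<omega>) * draw_prob f i (Y n \<omega>)) \<in> borel_measurable M"
    by (rule composition_fun_measurable)
  note ce = F.real_cond_exp_intg[OF int gY borel_measurable_indicator[OF S]]
  show "integrable M (\<lambda>\<omega>. g (Y n \<omega>) * draw_prob f i (Y n \<omega>))"
    by (rule integrable_cong_AE_imp[OF ce(1) meas]) (use AE in auto)
  show "(\<integral>\<omega>. g (Y n \<omega>) * indicator (S i n) \<omega> \<partial>M)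
      = (\<integral>\<omega>. g (Y n \<omega>) * draw_prob f i (Y n \<omega>) \<partial>M)"
    unfolding ce(2)[symmetric]
    by (rule integral_cong_AE[OF _ meas AE]) (use ce(1) in auto)
qed

lemma axis_2_neq: "axis 1 1 \<noteq> (axis 2 1 :: nat ^ 2)"
  by (auto simp: axis_def vec_eq_iff)

text \<open>
  The one-step transition of the composition as a Markov chain. It is the only trace of the drawing rule
  needed for the tail estimates, and it reduces them to inequalities that hold at each fixed composition.
\<close>
lemma expectation_step:
  fixes g :: "nat ^ 2 \<Rightarrow> real"
  assumes bound: "\<And>y. \<bar>g y\<bar> \<le> K"
  shows "expectation (\<lambda>\<omega>. g (Y (Suc n) \<omega>))
    = expectation (\<lambda>\<omega>. \<Sum>i\<in>UNIV. draw_prob f i (Y n \<omega>) * g (add_balls H i (Y n \<omega>)))"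
    and "integrable M (\<lambda>\<omega>. \<Sum>i\<in>UNIV. draw_prob f i (Y n \<omega>) * g (add_balls H i (Y n \<omega>)))"
proof -
  define S where "S i n = {\<omega> \<in> space M. X (Suc n) \<omega> = axis i 1}" for i n
  note draw = integral_draw[of "\<lambda>y. g (add_balls H i y)" K n i for i, OF bound, folded S_def]
  have "g (Y (Suc n) \<omega>) = (\<Sum>i\<in>UNIV. g (add_balls H i (Y n \<omega>)) * indicator (S i n) \<omega>)"
    if "\<omega> \<in> space M" for \<omega>
    using draw_colour[OF that, of n] axis_2_neq axis_2_neq[symmetric] that
    by (auto simp: sum_2 S_def evolution add_balls_def)
  then have "expectation (\<lambda>\<omega>. g (Y (Suc n) \<omega>))
      = expectation (\<lambda>\<omega>. \<Sum>i\<in>UNIV. g (add_balls H i (Y n \<omega>)) * indicator (S i n) \<omega>)"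
    by (intro Bochner_Integration.integral_cong) auto
  also have "\<dots> = (\<Sum>i\<in>UNIV. expectation (\<lambda>\<omega>. g (add_balls H i (Y n \<omega>)) * indicator (S i n) \<omega>))"
    by (rule Bochner_Integration.integral_sum, rule draw(1))
  also have "\<dots> = (\<Sum>i\<in>UNIV. expectation (\<lambda>\<omega>. g (add_balls H i (Y n \<omega>)) * draw_prob f i (Y n \<omega>)))"
    by (intro sum.cong refl draw(3))
  also have "\<dots> = expectation (\<lambda>\<omega>. \<Sum>i\<in>UNIV. g (add_balls H i (Y n \<omega>)) * draw_prob f i (Y n \<omega>))"
    by (rule Bochner_Integration.integral_sum [symmetric], rule draw(2))
  finally show "expectation (\<lambda>\<omega>. g (Y (Suc n) \<omega>))
    = expectation (\<lambda>\<omega>. \<Sum>i\<in>UNIV. draw_prob f i (Y n \<omega>) * g (add_balls H i (Y n \<omega>)))"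
    by (simp only: mult.commute)
  have "integrable M (\<lambda>\<omega>. \<Sum>i\<in>UNIV. g (add_balls H i (Y n \<omega>)) * draw_prob f i (Y n \<omega>))"
    by (intro Bochner_Integration.integrable_sum draw(2))
  then show "integrable M (\<lambda>\<omega>. \<Sum>i\<in>UNIV. draw_prob f i (Y n \<omega>) * g (add_balls H i (Y n \<omega>)))"
    by (simp only: mult.commute)
qed

lemma urn_total_bounds:
  assumes "\<And>i. col_total H i > 0" and \<omega>: "\<omega> \<in> space M"
  shows "Suc n \<le> urn_total (Y n \<omega>)"
    and "urn_total (Y n \<omega>) \<le> (urn_total y0 + col_total H 1 + col_total H 2) * Suc n"
proof -
  have step: "urn_total (Y (Suc n) \<omega>) \<in> {urn_total (Y n \<omega>) + col_total H 1, urn_total (Y n \<omega>) + col_total H 2}"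
    for n
    using draw_colour[OF \<omega>, of n] urn_total_add_balls[of H _ "Y n \<omega>"]
    by (auto simp: evolution[OF \<omega>] add_balls_def)
  have pos: "col_total H 1 > 0" "col_total H 2 > 0" using assms by auto
  have y0: "urn_total y0 > 0" using initial_pos[of 1] by (simp add: urn_total_2)
  show "Suc n \<le> urn_total (Y n \<omega>)"
  proof (induction n)
    case 0
    then show ?case using y0 by (simp add: initial[OF \<omega>])
  next
    case (Suc n)
    then show ?case using step[of n] pos by auto
  qed
  show "urn_total (Y n \<omega>) \<le> (urn_total y0 + col_total H 1 + col_total H 2) * Suc n"
  proof (induction n)
    case 0
    then show ?case by (simp add: initial[OF \<omega>])
  next
    case (Suc n)
    then show ?case using step[of n] by auto
  qed
qed


end

section \<open>Exponential tails\<close>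

text \<open>
  Beyond \<open>c\<close> the drift contributes \<open>- l * \<delta> / T\<close> to the exponent. The last condition on \<open>l\<close> says that the
  second-order terms use up at most half of it, and \<open>T \<le> G * Suc n\<close> turns the rest into a
  deterministic factor. Before \<open>c\<close> the exponent is at most \<open>0\<close>, so the moment after the
  draw is at most \<open>exp 1\<close>.
\<close>
lemma (in nonlinear_urn) exponential_moment_recursion:
  fixes l c sg \<delta> :: real
  defines "C \<equiv> real (col_total H 1) + real (col_total H 2)"
    and "G \<equiv> real (urn_total y0 + col_total H 1 + col_total H 2)"
    and "e \<equiv> \<lambda>n. expectation (\<lambda>\<omega>. exp (l * (sg * proportion 1 (Y n \<omega>) - c)))"
  assumes f: "\<forall>x\<in>{0..1}. f x \<ge> 0" "\<forall>x\<in>{0<..1}. f x > 0"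
    and H: "\<And>i. col_total H i > 0" and sg: "\<bar>sg\<bar> = 1" and \<delta>: "\<delta> > 0"
    and drift: "\<And>z. z \<in> {0..1} \<Longrightarrow> sg * z \<ge> c \<Longrightarrow> sg * drift H f z \<le> - \<delta>"
    and l: "0 \<le> l" "l * C \<le> real (Suc n)" "(1 + l) * C\<^sup>2 / real (Suc n) \<le> \<delta> / 2"
  shows "e (Suc n) \<le> exp (- (l * \<delta> / (2 * G) * (1 / real (Suc n)))) * e n + exp 1"
proof -
  define g where "g y = exp (l * (sg * proportion 1 y - c))" for y
  define q where "q = exp (- (l * \<delta> / (2 * G) * (1 / real (Suc n))))"
  have gb: "\<bar>g y\<bar> \<le> exp (l * (1 + \<bar>c\<bar>))" for y
  proof -
    have "sg * proportion 1 y \<le> 1"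
      using sg proportion_bounds[of 1 y] by (auto simp: abs_if split: if_splits)
    then have "sg * proportion 1 y - c \<le> 1 + \<bar>c\<bar>" by linarith
    then show ?thesis using l(1) by (simp add: g_def mult_left_mono)
  qed
  have pointwise: "(\<Sum>i\<in>UNIV. draw_prob f i (Y n \<omega>) * g (add_balls H i (Y n \<omega>)))
      \<le> q * g (Y n \<omega>) + exp 1" if \<omega>: "\<omega> \<in> space M" for \<omega>
  proof -
    define T z where "T = real (urn_total (Y n \<omega>))" and "z = proportion 1 (Y n \<omega>)"
    have T: "real (Suc n) \<le> T" "T \<le> G * real (Suc n)"
      unfolding T_def G_def of_nat_mult[symmetric] of_nat_le_iff
      using urn_total_bounds[OF H \<omega>] by blast+
    have T0: "T > 0" using T(1) by linarith
    note bound = exponential_step_bound[of f "Y n \<omega>" sg l H c, OF f _ sg l(1), folded g_def C_def T_def z_def]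
    have bound1: "(\<Sum>i\<in>UNIV. draw_prob f i (Y n \<omega>) * g (add_balls H i (Y n \<omega>))) \<le>
        g (Y n \<omega>) * exp (l * (sg * drift H f z) / T + (l + l\<^sup>2) * C\<^sup>2 / T\<^sup>2)"
      and bound2: "(\<Sum>i\<in>UNIV. draw_prob f i (Y n \<omega>) * g (add_balls H i (Y n \<omega>))) \<le>
        g (Y n \<omega>) * exp 1"
      using bound T0 T l(2) by (simp_all add: T_def)
    show ?thesis
    proof (cases "c \<le> sg * z")
      case True
      then have h: "sg * drift H f z \<le> - \<delta>"
        using drift proportion_bounds by (simp add: z_def)
      have "l * (sg * drift H f z) / T \<le> l * (- \<delta>) / T"
        using h l(1) T0 by (intro divide_right_mono mult_left_mono) auto
      moreover have "(l + l\<^sup>2) * C\<^sup>2 / T\<^sup>2 \<le> l / T * (\<delta> / 2)"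
      proof -
        have "(1 + l) * C\<^sup>2 / T \<le> (1 + l) * C\<^sup>2 / real (Suc n)"
          using T(1) l(1) by (intro divide_left_mono) auto
        then have "(1 + l) * C\<^sup>2 / T \<le> \<delta> / 2" using l(3) by linarith
        then have "l / T * ((1 + l) * C\<^sup>2 / T) \<le> l / T * (\<delta> / 2)"
          using l(1) T0 by (intro mult_left_mono) auto
        moreover have "(l + l\<^sup>2) * C\<^sup>2 / T\<^sup>2 = l / T * ((1 + l) * C\<^sup>2 / T)"
          using T0 by (simp add: power2_eq_square field_simps)
        ultimately show ?thesis by simp
      qed
      ultimately have "l * (sg * drift H f z) / T + (l + l\<^sup>2) * C\<^sup>2 / T\<^sup>2 \<le> - (l * \<delta> / 2 / T)"
        by (simp add: field_simps)
      also have "\<dots> \<le> - (l * \<delta> / 2 / (G * real (Suc n)))"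
        using T T0 l(1) \<delta> by (intro le_imp_neg_le divide_left_mono) auto
      finally have "exp (l * (sg * drift H f z) / T + (l + l\<^sup>2) * C\<^sup>2 / T\<^sup>2) \<le> q"
        by (simp add: q_def)
      then have "g (Y n \<omega>) * exp (l * (sg * drift H f z) / T + (l + l\<^sup>2) * C\<^sup>2 / T\<^sup>2)
          \<le> g (Y n \<omega>) * q" by (intro mult_left_mono) (auto simp: g_def)
      also have "\<dots> \<le> q * g (Y n \<omega>) + exp 1" by simp
      finally show ?thesis using bound1 by linarith
    next
      case False
      then have "l * (sg * z - c) \<le> 0" using l(1) by (intro mult_nonneg_nonpos) auto
      then have "g (Y n \<omega>) * exp 1 \<le> exp 1" by (simp add: g_def z_def)
      moreover have "0 \<le> q * g (Y n \<omega>)" by (simp add: q_def g_def)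
      ultimately show ?thesis using bound2 by linarith
    qed
  qed
  have int: "integrable M (\<lambda>\<omega>. g (Y n \<omega>))" by (rule composition_fun_integrable[OF gb])
  have "expectation (\<lambda>\<omega>. g (Y (Suc n) \<omega>))
      = expectation (\<lambda>\<omega>. \<Sum>i\<in>UNIV. draw_prob f i (Y n \<omega>) * g (add_balls H i (Y n \<omega>)))"
    by (rule expectation_step(1)[OF gb])
  also have "\<dots> \<le> expectation (\<lambda>\<omega>. q * g (Y n \<omega>) + exp 1)"
    using pointwise int by (intro integral_mono expectation_step(2)[OF gb]) auto
  also have "\<dots> = q * expectation (\<lambda>\<omega>. g (Y n \<omega>)) + exp 1"
    using int by (simp add: prob_space)
  finally show ?thesis by (simp add: e_def g_def q_def)
qed

text \<open>
  The exponent \<open>s * N\<close> is proportional to the final time \<open>N\<close>, which makes Markov's inequality exponentially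
  strong, but the recursion only tolerates exponents of the order of the current time. Hence it
  is run on the window from \<open>\<kappa> * N\<close> to \<open>N\<close>, with \<open>s\<close> small compared to \<open>\<kappa>\<close>.
\<close>
lemma (in nonlinear_urn) one_sided_tail:
  fixes c sg \<delta> \<eta> :: real
  assumes f: "\<forall>x\<in>{0..1}. f x \<ge> 0" "\<forall>x\<in>{0<..1}. f x > 0"
    and H: "\<And>i. col_total H i > 0" and sg: "\<bar>sg\<bar> = 1" and \<delta>: "\<delta> > 0" and \<eta>: "\<eta> > 0"
    and drift: "\<And>z. z \<in> {0..1} \<Longrightarrow> sg * z \<ge> c \<Longrightarrow> sg * drift H f z \<le> - \<delta>"
  shows "\<exists>a>0. \<forall>\<^sub>F n in sequentially.
    prob {\<omega> \<in> space M. sg * proportion 1 (Y n \<omega>) > c + \<eta>} \<le> exp (- a * real n)"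
proof -
  define C where "C = real (col_total H 1) + real (col_total H 2)"
  define G where "G = real (urn_total y0 + col_total H 1 + col_total H 2)"
  \<comment> \<open>\<open>L\<close> is the value that the sum of reciprocals must reach in order to cancel the trivial bound
    \<open>exp (s * N * (1 + \<bar>c\<bar>))\<close> on the moment at the start of the window. With the factor \<open>1 / 2\<close> in \<open>\<kappa>\<close>,
    rounding \<open>\<kappa> * N\<close> to an integer does no harm.\<close>
  define L where "L = 2 * G * (1 + \<bar>c\<bar>) / \<delta>"
  define \<kappa> where "\<kappa> = exp (- L) / 2"
  \<comment> \<open>The two terms of the minimum serve the two conditions on the exponent in the recursion.\<close>
  define s where "s = min (\<kappa> / C) (\<kappa> * \<delta> / (4 * C\<^sup>2))"
  have C: "C > 0" and G: "G > 0" using H[of 1] by (auto simp: C_def G_def)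
  have L: "L \<ge> 0" using G \<delta> by (simp add: L_def)
  have \<kappa>: "0 < \<kappa>" "\<kappa> < 1"
  proof -
    have "exp (- L) \<le> 1" using L by simp
    then show "0 < \<kappa>" "\<kappa> < 1" unfolding \<kappa>_def by (simp, linarith)
  qed
  have s: "s > 0" "s * C \<le> \<kappa>" "s * C\<^sup>2 \<le> \<kappa> * \<delta> / 4"
  proof -
    show "s > 0" using C \<kappa> \<delta> by (simp add: s_def)
    have "s \<le> \<kappa> / C" "s \<le> \<kappa> * \<delta> / (4 * C\<^sup>2)" by (auto simp: s_def)
    then show "s * C \<le> \<kappa>" "s * C\<^sup>2 \<le> \<kappa> * \<delta> / 4" using C by (auto simp: field_simps)
  qed
  define e where "e N n = expectation (\<lambda>\<omega>. exp (s * real N * (sg * proportion 1 (Y n \<omega>) - c)))" for N n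
  have small: "sg * proportion 1 y - c \<le> 1 + \<bar>c\<bar>" for y
    using sg proportion_bounds[of 1 y] by (auto simp: abs_if split: if_splits)
  have moment: "e N N \<le> 1 + exp 1 * real N"
    if N: "real N \<ge> 1 / \<kappa>" "real N \<ge> 4 * C\<^sup>2 / (\<kappa> * \<delta>)" for N
  proof -
    define l where "l = s * real N"
    define m where "m = nat \<lfloor>\<kappa> * real N\<rfloor>"
    have l: "l \<ge> 0" using s by (simp add: l_def)
    have N1: "1 \<le> \<kappa> * real N" using N(1) \<kappa> by (simp add: field_simps)
    have m: "real m \<le> \<kappa> * real N" "\<kappa> * real N \<le> real (Suc m)"
      unfolding m_def using \<kappa> by (simp_all add: of_nat_nat) linarith
    have "\<kappa> * real N \<le> 1 * real N" using \<kappa> by (intro mult_right_mono) auto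
    then have mN: "m \<le> N" using m(1) by linarith
    have sm2: "real (Suc m) \<le> 2 * \<kappa> * real N" using m(1) N1 by simp
    have rec: "e N (Suc k) \<le> exp (- (l * \<delta> / (2 * G) * (1 / real (Suc k)))) * e N k + exp 1"
      if k: "m \<le> k" "k < N" for k
    proof -
      have kN: "\<kappa> * real N \<le> real (Suc k)" using m(2) k(1) by linarith
      have 1: "l * C \<le> real (Suc k)"
      proof -
        have "l * C \<le> \<kappa> * real N"
          using mult_right_mono[OF s(2), of "real N"] by (simp add: l_def mult_ac)
        then show ?thesis using kN by linarith
      qed
      have 2: "(1 + l) * C\<^sup>2 / real (Suc k) \<le> \<delta> / 2"
      proof -
        have "C\<^sup>2 \<le> \<kappa> * real N * \<delta> / 4"
          using N(2) \<kappa> \<delta> by (simp add: field_simps)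
        moreover have "l * C\<^sup>2 \<le> \<kappa> * real N * \<delta> / 4"
          using mult_right_mono[OF s(3), of "real N"] by (simp add: l_def mult_ac)
        ultimately have "(1 + l) * C\<^sup>2 \<le> \<kappa> * real N * (\<delta> / 2)" by (simp add: algebra_simps)
        also have "\<dots> \<le> real (Suc k) * (\<delta> / 2)" using kN \<delta> by (intro mult_right_mono) auto
        finally show ?thesis by (simp add: divide_le_eq mult_ac)
      qed
      show ?thesis
        unfolding e_def l_def[symmetric] G_def
        by (rule exponential_moment_recursion[OF f H sg \<delta> drift l 1[unfolded C_def] 2[unfolded C_def]])
    qed
    have "e N N \<le> exp (- (\<Sum>k=m..<N. l * \<delta> / (2 * G) * (1 / real (Suc k)))) * e N m
        + exp 1 * real (N - m)"
      using l \<delta> G by (intro affine_recursion_bound mN rec) auto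
    also have "(\<Sum>k=m..<N. l * \<delta> / (2 * G) * (1 / real (Suc k)))
        = l * \<delta> / (2 * G) * (\<Sum>k=m..<N. 1 / real (Suc k))"
      by (rule sum_distrib_left [symmetric])
    also have "exp (- (l * \<delta> / (2 * G) * (\<Sum>k=m..<N. 1 / real (Suc k)))) * e N m
        \<le> exp (- (l * (1 + \<bar>c\<bar>))) * exp (l * (1 + \<bar>c\<bar>))"
    proof (intro mult_mono)
      have "exp L = 1 / (2 * \<kappa>)" by (simp add: \<kappa>_def exp_minus field_simps)
      also have "\<dots> = real N / (2 * \<kappa> * real N)" using N1 by auto
      also have "\<dots> \<le> real (Suc N) / real (Suc m)"
        using sm2 by (intro frac_le) auto
      finally have "L \<le> ln (real (Suc N) / real (Suc m))"
        by (subst ln_ge_iff) auto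
      also have "\<dots> \<le> (\<Sum>k=m..<N. 1 / real (Suc k))"
        by (rule sum_reciprocals_ge_ln[OF mN])
      finally have "l * \<delta> / (2 * G) * L \<le> l * \<delta> / (2 * G) * (\<Sum>k=m..<N. 1 / real (Suc k))"
        using l \<delta> G by (intro mult_left_mono) auto
      moreover have "l * \<delta> / (2 * G) * L = l * (1 + \<bar>c\<bar>)"
        using \<delta> G by (simp add: L_def)
      ultimately show "exp (- (l * \<delta> / (2 * G) * (\<Sum>k=m..<N. 1 / real (Suc k)))) \<le> exp (- (l * (1 + \<bar>c\<bar>)))"
        by simp
      have le: "exp (l * (sg * proportion 1 y - c)) \<le> exp (l * (1 + \<bar>c\<bar>))" for y
        using small[of y] l by (simp add: mult_left_mono)
      have "e N m \<le> expectation (\<lambda>_. exp (l * (1 + \<bar>c\<bar>)))"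
        unfolding e_def l_def[symmetric]
        by (intro integral_mono composition_fun_integrable[of _ "exp (l * (1 + \<bar>c\<bar>))"]) (use le in auto)
      then show "e N m \<le> exp (l * (1 + \<bar>c\<bar>))" by (simp add: prob_space)
      show "0 \<le> e N m" unfolding e_def by (rule Bochner_Integration.integral_nonneg) simp
    qed simp
    also have "exp (- (l * (1 + \<bar>c\<bar>))) * exp (l * (1 + \<bar>c\<bar>)) = 1" by (simp flip: exp_add)
    also have "exp 1 * real (N - m) \<le> exp 1 * real N" by simp
    finally show ?thesis by simp
  qed
  have tail: "prob {\<omega> \<in> space M. sg * proportion 1 (Y N \<omega>) > c + \<eta>} \<le> e N N * exp (- (s * \<eta>) * real N)"
    if "N > 0" for N
  proof -
    define g where "g \<omega> = exp (s * real N * (sg * proportion 1 (Y N \<omega>) - c))" for \<omega>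
    have sN: "s * real N > 0" using s that by simp
    have "{\<omega> \<in> space M. sg * proportion 1 (Y N \<omega>) > c + \<eta>} \<subseteq> {\<omega> \<in> space M. g \<omega> \<ge> exp (s * real N * \<eta>)}"
      using sN by (auto simp: g_def intro!: mult_left_mono)
    moreover have meas: "g \<in> borel_measurable M"
      unfolding g_def by (rule composition_fun_measurable)
    ultimately have "prob {\<omega> \<in> space M. sg * proportion 1 (Y N \<omega>) > c + \<eta>}
        \<le> prob {\<omega> \<in> space M. g \<omega> \<ge> exp (s * real N * \<eta>)}"
      by (intro finite_measure_mono) auto
    also have "\<dots> \<le> expectation g / exp (s * real N * \<eta>)"
    proof (rule integral_Markov_inequality_measure)
      have "exp (s * real N * (sg * proportion 1 y - c)) \<le> exp (s * real N * (1 + \<bar>c\<bar>))" for y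
        using small[of y] sN by (simp add: mult_left_mono)
      then show "integrable M g"
        unfolding g_def by (intro composition_fun_integrable[of _ "exp (s * real N * (1 + \<bar>c\<bar>))"]) simp
    qed (use meas in \<open>auto simp: g_def\<close>)
    also have "\<dots> = e N N * exp (- (s * \<eta>) * real N)"
      unfolding e_def g_def [abs_def] by (simp add: exp_minus divide_inverse mult_ac)
    finally show ?thesis .
  qed
  have "\<forall>\<^sub>F N in sequentially. 1 + exp 1 * real N \<le> exp (s * \<eta> / 2 * real N)"
    using s \<eta> by real_asymp
  moreover have "\<forall>\<^sub>F N in sequentially. real N \<ge> 1 / \<kappa>" "\<forall>\<^sub>F N in sequentially. real N \<ge> 4 * C\<^sup>2 / (\<kappa> * \<delta>)"
    by real_asymp+
  moreover have "\<forall>\<^sub>F N::nat in sequentially. N > 0" by (rule eventually_gt_at_top)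
  ultimately have "\<forall>\<^sub>F N in sequentially.
    prob {\<omega> \<in> space M. sg * proportion 1 (Y N \<omega>) > c + \<eta>} \<le> exp (- (s * \<eta> / 2) * real N)"
  proof eventually_elim
    case (elim N)
    have "e N N * exp (- (s * \<eta>) * real N) \<le> exp (s * \<eta> / 2 * real N) * exp (- (s * \<eta>) * real N)"
      using moment[OF elim(2,3)] elim(1) by (intro mult_right_mono) auto
    also have "\<dots> = exp (- (s * \<eta> / 2) * real N)" by (simp flip: exp_add)
    finally show ?case using tail[OF elim(4)] by linarith
  qed
  moreover have "s * \<eta> / 2 > 0" using s \<eta> by simp
  ultimately show ?thesis by blast
qed

theorem theorem2p1:
  fixes M :: "'a measure"
    and H :: "nat ^ 2 ^ 2"
    and f :: "real \<Rightarrow> real"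
    and y0 :: "nat ^ 2"
    and X Y :: "nat \<Rightarrow> 'a \<Rightarrow> nat ^ 2"
  assumes urn: "nonlinear_urn M H f y0 X Y"
    and C1: "\<forall>x\<in>{0..1}. f x \<ge> 0"
      "continuous_on {0..1} f"
      "mono_on {0..1} f"
      "\<forall>x\<in>{0<..<1}. f differentiable (at x)"
      "f 0 = 0"
      "f 1 = 1"
      "\<forall>x\<in>{0<..1}. f x > 0"
      "f differentiable (at_right 0)"
      "f differentiable (at_left 1)"
    and C2: "col_total H 1 \<noteq> col_total H 2"
    and C3: "\<forall>n. \<forall>\<omega>\<in>space M. urn_total (Y n \<omega>) > 0"
    and C4: "\<exists>i j. H $ i $ j \<noteq> 0" "H $ 1 $ 2 > 0" "H $ 2 $ 1 > 0"
    and concave: "real (H $ 1 $ 1) / real (col_total H 1) >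
        real (H $ 1 $ 2) / real (col_total H 2) \<longrightarrow> concave_on {0..1} f"
    and drift_decreasing: "antimono_on {0..1} (drift H f)"
  shows "\<forall>\<epsilon>>0. \<exists>a>0. \<forall>\<^sub>F n in sequentially.
    measure M {\<omega> \<in> space M. \<bar>proportion 1 (Y (Suc n) \<omega>) - equilibrium H f\<bar> > \<epsilon>}
      \<le> 2 * exp (- a * real n)"
proof (intro allI impI)
  fix \<epsilon> :: real assume \<epsilon>: "\<epsilon> > 0"
  interpret nonlinear_urn M H f y0 X Y by (rule urn)
  define e where "e = equilibrium H f"
  have ex1: "\<exists>!y. y \<in> {0..1} \<and> drift H f y = 0"
  proof -
    obtain y where "y \<in> {0..1}" "drift H f y = 0"
      using drift_zero_exists[OF C1(1,7,5,2)] by blast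
    moreover have "a = b" if "a \<in> {0..1}" "drift H f a = 0" "b \<in> {0..1}" "drift H f b = 0" for a b
      using drift_zero_unique[OF C1(1,7,5,3) C4(2,3) concave] that
      by (metis linorder_neqE_linordered_idom)
    ultimately show ?thesis by blast
  qed
  then have e: "e \<in> {0..1}" "drift H f e = 0"
    using theI'[OF ex1] by (auto simp: e_def equilibrium_def)
  have uniq: "y = e" if "y \<in> {0..1}" "drift H f y = 0" for y
    using ex1 e that by blast
  have H: "col_total H i > 0" for i
    using exhaust_2[of i] C4(2,3) by (auto simp: col_total_2)
  have side: "\<exists>a>0. \<forall>\<^sub>F n in sequentially.
      prob {\<omega> \<in> space M. sg * proportion 1 (Y n \<omega>) > sg * e + \<epsilon>} \<le> exp (- a * real n)"
    if sg: "sg \<in> {1, -1}" for sg :: real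
  proof -
    have \<epsilon>2: "\<epsilon> / 2 > 0" using \<epsilon> by simp
    obtain \<delta> where \<delta>: "\<delta> > 0" "\<And>z. z \<in> {0..1} \<Longrightarrow> sg * z \<ge> sg * e + \<epsilon> / 2 \<Longrightarrow> sg * drift H f z \<le> - \<delta>"
      using drift_strict_sign[OF drift_decreasing e uniq sg \<epsilon>2] by blast
    have "\<bar>sg\<bar> = 1" "sg * e + \<epsilon> / 2 + \<epsilon> / 2 = sg * e + \<epsilon>" using sg by auto
    then show ?thesis
      using one_sided_tail[OF C1(1,7) H _ \<delta>(1) \<epsilon>2, of sg "sg * e + \<epsilon> / 2"] \<delta>(2)
      by (simp add: add.commute)
  qed
  obtain a where a: "a > 0" "\<forall>\<^sub>F n in sequentially.
      prob {\<omega> \<in> space M. 1 * proportion 1 (Y n \<omega>) > 1 * e + \<epsilon>} \<le> exp (- a * real n)"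
    using side[of 1] by blast
  obtain b where b: "b > 0" "\<forall>\<^sub>F n in sequentially.
      prob {\<omega> \<in> space M. -1 * proportion 1 (Y n \<omega>) > -1 * e + \<epsilon>} \<le> exp (- b * real n)"
    using side[of "-1"] by blast
  have "\<forall>\<^sub>F n in sequentially.
    prob {\<omega> \<in> space M. \<bar>proportion 1 (Y n \<omega>) - e\<bar> > \<epsilon>} \<le> 2 * exp (- min a b * real n)"
    using a(2) b(2)
  proof eventually_elim
    case (elim n)
    let ?U = "{\<omega> \<in> space M. 1 * proportion 1 (Y n \<omega>) > 1 * e + \<epsilon>}"
    let ?V = "{\<omega> \<in> space M. -1 * proportion 1 (Y n \<omega>) > -1 * e + \<epsilon>}"
    have meas: "?U \<in> events" "?V \<in> events"
      using composition_fun_measurable[of "proportion 1" n] by measurable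
    have "{\<omega> \<in> space M. \<bar>proportion 1 (Y n \<omega>) - e\<bar> > \<epsilon>} = ?U \<union> ?V" by auto
    then have "prob {\<omega> \<in> space M. \<bar>proportion 1 (Y n \<omega>) - e\<bar> > \<epsilon>} \<le> prob ?U + prob ?V"
      using measure_Un_le[OF meas] by simp
    also have "\<dots> \<le> exp (- a * real n) + exp (- b * real n)" using elim by (intro add_mono)
    also have "\<dots> \<le> exp (- min a b * real n) + exp (- min a b * real n)"
      by (intro add_mono) (auto intro!: mult_right_mono)
    finally show ?case by simp
  qed
  then have "\<forall>\<^sub>F n in sequentially.
    prob {\<omega> \<in> space M. \<bar>proportion 1 (Y (Suc n) \<omega>) - e\<bar> > \<epsilon>} \<le> 2 * exp (- min a b * real (Suc n))"
    by (subst eventually_sequentially_Suc)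
  then have "\<forall>\<^sub>F n in sequentially.
    prob {\<omega> \<in> space M. \<bar>proportion 1 (Y (Suc n) \<omega>) - e\<bar> > \<epsilon>} \<le> 2 * exp (- min a b * real n)"
  proof eventually_elim
    case (elim n)
    have "exp (- min a b * real (Suc n)) \<le> exp (- min a b * real n)"
      using a(1) b(1) by simp
    then show ?case using elim by linarith
  qed
  then show "\<exists>a>0. \<forall>\<^sub>F n in sequentially.
    prob {\<omega> \<in> space M. \<bar>proportion 1 (Y (Suc n) \<omega>) - equilibrium H f\<bar> > \<epsilon>} \<le> 2 * exp (- a * real n)"
    unfolding e_def using a(1) b(1) by (intro exI[of _ "min a b"]) simp
qed

end
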